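(* Let $A_s=\mathrm{diag}(\lambda_1,\ldots,\lambda_n)$ with $\lambda_i\in\mathbb C$, let $q:=\dim_{\mathbb Q}(\mathbb Q\lambda_1+\cdots+\mathbb Q\lambda_n)$, and assume there exist integers $d_1>0,\ldots,d_n>0$ such that $\sum d_i\lambda_i=0$. Then, for any given formal vector field $f=A_s+\cdots$ in Poincaré–Dulac normal form (with $A_s$ the semisimple part of its linear part), the subspace of linear vector fields in $\mathcal C^{\rm for}(f)$ has dimension $\ge q$, and $\dim\mathcal C^{\rm for}(f)\ge q+1$. Moreover, Z-generically the subspace of linear vector fields in the centralizer $\mathcal C^{\rm for}(f)$ has dimension $q$.
   Context: Formal vector fields on $\mathbb C^n$ are elements of $\mathbb C[[x_1,\ldots,x_n]]^n$; a matrix $B$ is identified with the linear vector field $x\mapsto Bx$. The Lie bracket is $[g,h](x)=Dh(x)g(x)-Dg(x)h(x)$, and $\mathcal C^{\rm for}(f)=\{g\in\mathbb C[[x_1,\ldots,x_n]]^n;\ [g,f]=0\}$; dimensions of centralizers are over $\mathbb C$. For $f(x)=Ax+\sum_{j\ge2}f_j(x)$ ($f_j$ homogeneous of degree $j$) with Jordan–Chevalley decomposition $A=A_s+A_n$, $f$ is in Poincaré–Dulac normal form (PDNF) if $[A_s,f]=0$. Standing convention: $A_s$ is diagonal and $A_n$ is strictly upper triangular. A condition for PDNF with given $A_s$ holds Z-generically if there exists a positive integer $m$ such that the condition holds for a Zariski open and dense subset of the (finite dimensional vector) space of all polynomial vector fields $\widetilde f=A_n+\sum_{j=2}^m f_j$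 such that $f=A_s+\widetilde f$ is in PDNF. *)

theory Defs
  imports
    "HOL-Analysis.Analysis"
    "HOL-Library.Function_Algebras"
    "HOL-Library.Extended_Nat"
begin

section \<open>Formal power series and formal vector fields\<close>

text \<open>
  A series is its family of coefficients, indexed by exponent vectors. Addition is that of
  \<^theory>\<open>HOL-Library.Function_Algebras\<close>; the multiplication of that theory is pointwise,
  hence not the product of series, which is \<open>mps_mult\<close> below.
\<close>

type_synonym 'n mps = "nat^'n \<Rightarrow> complex"

type_synonym 'n vfield = "('n mps)^'n"

definition total_degree :: "nat^'n::finite \<Rightarrow> nat"
  where "total_degree k = (\<Sum>i\<in>UNIV. k $ i)"

definition mps_mult :: "'n::finite mps \<Rightarrow> 'n mps \<Rightarrow> 'n mps"
  where "mps_mult a b = (\<lambda>k. \<Sum>(r, s) \<in> {(r, s). r + s = k}. a r * b s)"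

definition mps_pderiv :: "'n::finite \<Rightarrow> 'n mps \<Rightarrow> 'n mps"
  where "mps_pderiv j a = (\<lambda>k. of_nat (k $ j + 1) * a (k + axis j 1))"

definition lie_bracket :: "'n::finite vfield \<Rightarrow> 'n vfield \<Rightarrow> 'n vfield"
  where "lie_bracket g h =
    (\<chi> i. (\<Sum>j\<in>UNIV. mps_mult (mps_pderiv j (h $ i)) (g $ j))
        - (\<Sum>j\<in>UNIV. mps_mult (mps_pderiv j (g $ i)) (h $ j)))"

definition centralizer :: "'n::finite vfield \<Rightarrow> 'n vfield set"
  where "centralizer f = {g. lie_bracket g f = 0}"

text \<open>The linear vector field \<open>x \<mapsto> B x\<close>; the exponent vector \<open>axis j 1\<close> is that of \<open>x\<^sub>j\<close>.\<close>

definition lin_vfield :: "complex^'n^'n::finite \<Rightarrow> 'n vfield"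
  where "lin_vfield B = (\<chi> i. (\<lambda>k. \<Sum>j\<in>UNIV. if k = axis j 1 then B $ i $ j else 0))"

definition linear_part :: "'n::finite vfield \<Rightarrow> complex^'n^'n"
  where "linear_part f = (\<chi> i j. (f $ i) (axis j 1))"


section \<open>Dimensions\<close>

definition vf_scale :: "complex \<Rightarrow> 'n::finite vfield \<Rightarrow> 'n vfield"
  where "vf_scale c g = (\<chi> i. (\<lambda>k. c * (g $ i) k))"

global_interpretation vf: vector_space "vf_scale :: complex \<Rightarrow> 'n::finite vfield \<Rightarrow> 'n vfield"
  by unfold_locales (simp_all add: vf_scale_def vec_eq_iff fun_eq_iff algebra_simps)

text \<open>The library dimension is a natural number, without meaning for spaces of infinite
  dimension; centralizers may be such spaces.\<close>

definition vf_edim :: "'n::finite vfield set \<Rightarrow> enat"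
  where "vf_edim V =
    (if \<exists>B. finite B \<and> V \<subseteq> vf.span B then enat (vf.dim V) else \<infinity>)"

global_interpretation rat_vs: vector_space "\<lambda>(r::rat) (z::complex). of_rat r * z"
  by unfold_locales (simp_all add: algebra_simps of_rat_add of_rat_mult)

definition rat_rank :: "complex^'n::finite \<Rightarrow> nat"
  where "rat_rank lam = rat_vs.dim (rat_vs.span (range (\<lambda>i. lam $ i)))"


section \<open>Poincare-Dulac normal form\<close>

definition diag_mat :: "complex^'n \<Rightarrow> complex^'n^'n::finite"
  where "diag_mat lam = (\<chi> i j. if i = j then lam $ i else 0)"

definition diagonalizable :: "complex^'n^'n::finite \<Rightarrow> bool"
  where "diagonalizable S \<longleftrightarrow>
    (\<exists>(P :: complex^'n^'n) lam. invertible P \<and> S = P ** diag_mat lam ** matrix_inv P)"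

definition nilpotent_mat :: "complex^'n^'n::finite \<Rightarrow> bool"
  where "nilpotent_mat N \<longleftrightarrow> (\<exists>k. (((**) N) ^^ k) (mat 1) = 0)"

definition strictly_upper :: "complex^'n::{finite,linorder}^'n::{finite,linorder} \<Rightarrow> bool"
  where "strictly_upper N \<longleftrightarrow> (\<forall>i j. j \<le> i \<longrightarrow> N $ i $ j = 0)"

definition jordan_chevalley ::
    "complex^'n^'n::finite \<Rightarrow> complex^'n^'n \<Rightarrow> complex^'n^'n \<Rightarrow> bool"
  where "jordan_chevalley A S N \<longleftrightarrow>
    A = S + N \<and> diagonalizable S \<and> nilpotent_mat N \<and> S ** N = N ** S"

text \<open>
  The semisimple part \<open>S\<close> of the linear part is an argument. The nilpotent part is required to
  be strictly upper triangular, by the usual convention (\<open>S\<close> itself is diagonal wherever this is used).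
\<close>

definition pdnf :: "complex^'n::{finite,linorder}^'n::{finite,linorder} \<Rightarrow> 'n vfield \<Rightarrow> bool"
  where "pdnf S f \<longleftrightarrow>
    (\<forall>i. (f $ i) 0 = 0) \<and>
    (\<exists>N. jordan_chevalley (linear_part f) S N \<and> strictly_upper N) \<and>
    lie_bracket (lin_vfield S) f = 0"


section \<open>Zariski-generic conditions\<close>

inductive_set poly_functions :: "('n::finite vfield \<Rightarrow> complex) set"
  where
    const: "(\<lambda>_. c) \<in> poly_functions"
  | linear: "Vector_Spaces.linear vf_scale (*) p \<Longrightarrow> p \<in> poly_functions"
  | add: "p \<in> poly_functions \<Longrightarrow> q \<in> poly_functions \<Longrightarrow> (\<lambda>g. p g + q g) \<in> poly_functions"
  | mult: "p \<in> poly_functions \<Longrightarrow> q \<in> poly_functions \<Longrightarrow> (\<lambda>g. p g * q g) \<in> poly_functions"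

text \<open>
  The Zariski topology on a finite-dimensional subspace \<open>V\<close>. Linear forms on \<open>V\<close> extend to the
  whole space, so the polynomial functions on \<open>V\<close> are the restrictions of the above.
\<close>

definition zariski_closed_in :: "'n::finite vfield set \<Rightarrow> 'n vfield set \<Rightarrow> bool"
  where "zariski_closed_in V Z \<longleftrightarrow>
    (\<exists>P \<subseteq> poly_functions. Z = {g \<in> V. \<forall>p\<in>P. p g = 0})"

definition zariski_open_in :: "'n::finite vfield set \<Rightarrow> 'n vfield set \<Rightarrow> bool"
  where "zariski_open_in V U \<longleftrightarrow> U \<subseteq> V \<and> zariski_closed_in V (V - U)"

definition zariski_dense_in :: "'n::finite vfield set \<Rightarrow> 'n vfield set \<Rightarrow> bool"
  where "zariski_dense_in V U \<longleftrightarrow>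
    U \<subseteq> V \<and> (\<forall>Z. zariski_closed_in V Z \<and> U \<subseteq> Z \<longrightarrow> Z = V)"

text \<open>The polynomial vector fields \<open>A\<^sub>n + f\<^sub>2 + \<dots> + f\<^sub>m\<close> whose sum with \<open>S\<close> is in normal form.\<close>

definition pdnf_space :: "complex^'n::{finite,linorder}^'n::{finite,linorder} \<Rightarrow> nat \<Rightarrow> 'n vfield set"
  where "pdnf_space S m =
    {g. (\<forall>i k. (g $ i) k \<noteq> 0 \<longrightarrow> 1 \<le> total_degree k \<and> total_degree k \<le> m) \<and>
        strictly_upper (linear_part g) \<and> pdnf S (lin_vfield S + g)}"

definition Z_generically ::
    "complex^'n::{finite,linorder}^'n::{finite,linorder} \<Rightarrow> ('n vfield \<Rightarrow> bool) \<Rightarrow> bool"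
  where "Z_generically S Q \<longleftrightarrow>
    (\<exists>m\<ge>1. \<exists>U. zariski_open_in (pdnf_space S m) U \<and> zariski_dense_in (pdnf_space S m) U \<and>
      (\<forall>g\<in>U. Q (lin_vfield S + g)))"

end

theory Submission
  imports Defs
begin

text \<open>
  A diagonal linear field commutes with a normal form \<open>f\<close> as soon as its eigenvalues satisfy the
  rational linear relations of those of \<open>A\<^sub>s\<close>. These diagonal fields form a \<open>q\<close>-dimensional space;
  \<open>f\<close> itself, or \<open>x\<^sup>d (x\<^sub>1, \<dots>, x\<^sub>n)\<close> if \<open>f\<close> is linear and diagonal, is a further element of the
  centralizer.

  That nothing else is linear and commutes with \<open>f\<close> is the nonvanishing of the determinant of a linear
  system whose coefficients are polynomial in \<open>f\<close>, hence an open condition, and dense on an affine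
  space as soon as it holds at one point. Such a point is \<open>\<phi> (x\<^sub>1, \<dots>, x\<^sub>n)\<close>, with \<open>\<phi>\<close> a sum of
  resonant monomials \<open>x\<^sup>a\<close>: a linear field \<open>B\<close> commutes with it iff it annihilates \<open>\<phi>\<close>. The
  monomial \<open>x\<^sup>d\<close>, whose exponents are all positive and whose degree is least, forces \<open>B\<close> to be
  diagonal, and the other monomials force the relations on its eigenvalues.
\<close>

section \<open>Brackets with linear vector fields\<close>

text \<open>Over an infinite index set the sum in \<open>mps_mult\<close> would be 0 by convention;
  here it is a genuine convolution.\<close>

lemma finite_vec_sums: "finite {(r, s). r + s = (k :: nat^'n::finite)}"
proof -
  have "finite {r :: nat^'n. \<forall>i. r $ i \<in> {..k $ i}}"
    by (rule finite_subset[of _ "vec_lambda ` (PiE UNIV (\<lambda>i. {..k $ i}))"])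
       (auto intro!: finite_PiE image_eqI[where x="vec_nth _"])
  then have "finite ({r :: nat^'n. \<forall>i. r $ i \<le> k $ i} \<times> {r :: nat^'n. \<forall>i. r $ i \<le> k $ i})"
    by simp
  then show ?thesis
    by (rule finite_subset[rotated]) auto
qed

text \<open>The coefficients of \<open>x\<^sub>l \<partial>a / \<partial>x\<^sub>j\<close>.\<close>

definition mps_euler :: "'n::finite \<Rightarrow> 'n \<Rightarrow> 'n mps \<Rightarrow> 'n mps"
  where "mps_euler j l a = (\<lambda>k. if k $ l = 0 then 0 else mps_pderiv j a (k - axis l 1))"

lemma mps_euler_same: "mps_euler j j a k = of_nat (k $ j) * a k"
proof (cases "k $ j = 0")
  case False
  then have "k - axis j 1 + axis j 1 = k" "(k - axis j 1) $ j + 1 = k $ j"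
    by (auto simp: vec_eq_iff axis_def)
  then show ?thesis
    by (simp add: mps_euler_def mps_pderiv_def)
qed (simp add: mps_euler_def)

text \<open>The only pair with second exponent \<open>axis l 1\<close> is
  \<open>(k - axis l 1, axis l 1)\<close>. It exists iff \<open>k $ l\<close> is positive; truncated
  subtraction forces the case distinction.\<close>

lemma mps_mult_linear:
  "mps_mult a (\<lambda>k. \<Sum>l\<in>UNIV. if k = axis l 1 then c l else 0) k =
    (\<Sum>l\<in>UNIV. if k $ l = 0 then 0 else c l * a (k - axis l 1))"
proof -
  let ?P = "{(r, s). r + s = k}"
  have "mps_mult a (\<lambda>k. \<Sum>l\<in>UNIV. if k = axis l 1 then c l else 0) k =
    (\<Sum>x\<in>?P. \<Sum>l\<in>UNIV. if snd x = axis l 1 then c l * a (fst x) else 0)"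
    unfolding mps_mult_def
    by (intro sum.cong) (auto simp: sum_distrib_left intro!: sum.cong)
  also have "\<dots> = (\<Sum>l\<in>UNIV. \<Sum>x\<in>?P. if snd x = axis l 1 then c l * a (fst x) else 0)"
    by (rule sum.swap)
  also have "\<dots> = (\<Sum>l\<in>UNIV. if k $ l = 0 then 0 else c l * a (k - axis l 1))"
  proof (rule sum.cong[OF refl])
    fix l
    show "(\<Sum>x\<in>?P. if snd x = axis l 1 then c l * a (fst x) else 0) =
      (if k $ l = 0 then 0 else c l * a (k - axis l 1))"
    proof (cases "k $ l = 0")
      case True
      have "snd x \<noteq> axis l 1" if "x \<in> ?P" for x
      proof
        assume "snd x = axis l 1"
        with that have "fst x $ l + 1 = k $ l"
          by (auto simp: axis_def)
        with True show False by simp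
      qed
      then show ?thesis using True by (simp add: sum.neutral)
    next
      case False
      then have *: "k - axis l 1 + axis l 1 = k"
        by (auto simp: vec_eq_iff axis_def)
      have "(\<Sum>x\<in>?P. if snd x = axis l 1 then c l * a (fst x) else 0) =
        (\<Sum>x\<in>?P. if x = (k - axis l 1, axis l 1) then c l * a (k - axis l 1) else 0)"
        by (intro sum.cong refl) (auto simp flip: add_diff_cancel_right')
      also have "\<dots> = c l * a (k - axis l 1)"
        using * by (subst sum.delta) (auto simp: finite_vec_sums)
      finally show ?thesis using False by simp
    qed
  qed
  finally show ?thesis .
qed

lemma mps_mult_const: "mps_mult (\<lambda>r. if r = 0 then c else 0) a k = c * a k"
proof -
  have "mps_mult (\<lambda>r. if r = 0 then c else 0) a k =
    (\<Sum>x\<in>{(r, s). r + s = k}. if x = (0, k) then c * a k else 0)"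
    unfolding mps_mult_def by (intro sum.cong) (auto split: if_splits)
  then show ?thesis
    by (subst (asm) sum.delta) (auto simp: finite_vec_sums)
qed

lemma mps_pderiv_lin_vfield:
  "mps_pderiv j (lin_vfield B $ i) = (\<lambda>r. if r = 0 then B $ i $ j else 0)"
proof
  fix r :: "nat^'a"
  have "r + axis j 1 = axis l 1 \<longleftrightarrow> r = 0 \<and> l = j" for l
  proof
    assume *: "r + axis j 1 = axis l 1"
    then have "r $ j + 1 = axis l 1 $ j"
      by (metis axis_nth vector_add_component)
    then have "l = j"
      by (auto simp: axis_def split: if_splits)
    with * show "r = 0 \<and> l = j"
      by (auto simp: vec_eq_iff)
  qed auto
  then show "mps_pderiv j (lin_vfield B $ i) r = (if r = 0 then B $ i $ j else 0)"
    by (auto simp: mps_pderiv_def lin_vfield_def)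
qed

lemma sum_fun_apply: "(\<Sum>j\<in>A. F j) k = (\<Sum>j\<in>A. F j k)" for F :: "'a \<Rightarrow> 'b \<Rightarrow> 'c::comm_monoid_add"
  by (induction A rule: infinite_finite_induct) auto

text \<open>The derivative of the linear field is the constant matrix \<open>B\<close>. The formula
  is linear in the entries of \<open>B\<close>, with coefficients linear in those of
  \<open>h\<close>; the test system below rests on this.\<close>

lemma lie_bracket_lin_vfield:
  "(lie_bracket (lin_vfield B) h $ i) k =
    (\<Sum>j\<in>UNIV. \<Sum>l\<in>UNIV. B $ j $ l * mps_euler j l (h $ i) k) - (\<Sum>j\<in>UNIV. B $ i $ j * (h $ j) k)"
proof -
  have "mps_mult (mps_pderiv j (h $ i)) (lin_vfield B $ j) k =
    (\<Sum>l\<in>UNIV. B $ j $ l * mps_euler j l (h $ i) k)" for j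
    unfolding lin_vfield_def vec_lambda_beta mps_mult_linear
    by (intro sum.cong) (auto simp: mps_euler_def)
  then show ?thesis
    by (simp add: lie_bracket_def sum_fun_apply mps_pderiv_lin_vfield mps_mult_const)
qed

text \<open>Monomial fields \<open>x^k e_i\<close> are eigenvectors of the bracket with a diagonal
  field.\<close>

lemma lie_bracket_diag:
  "(lie_bracket (lin_vfield (diag_mat mu)) h $ i) k =
    ((\<Sum>j\<in>UNIV. of_nat (k $ j) * mu $ j) - mu $ i) * (h $ i) k"
proof -
  have "(\<Sum>l\<in>UNIV. diag_mat mu $ j $ l * mps_euler j l (h $ i) k) = of_nat (k $ j) * mu $ j * (h $ i) k" for j
  proof -
    have "(\<Sum>l\<in>UNIV. diag_mat mu $ j $ l * mps_euler j l (h $ i) k)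
        = (\<Sum>l\<in>UNIV. if l = j then mu $ j * mps_euler j j (h $ i) k else 0)"
      by (intro sum.cong) (auto simp: diag_mat_def)
    then show ?thesis by (simp add: mps_euler_same mult_ac)
  qed
  moreover have "(\<Sum>j\<in>UNIV. diag_mat mu $ i $ j * (h $ j) k) = mu $ i * (h $ i) k"
  proof -
    have "(\<Sum>j\<in>UNIV. diag_mat mu $ i $ j * (h $ j) k) = (\<Sum>j\<in>UNIV. if j = i then mu $ i * (h $ i) k else 0)"
      by (intro sum.cong) (auto simp: diag_mat_def)
    then show ?thesis by simp
  qed
  ultimately show ?thesis
    by (simp add: lie_bracket_lin_vfield sum_distrib_right left_diff_distrib)
qed

lemma lie_bracket_self: "lie_bracket g g = 0"
  by (simp add: lie_bracket_def vec_eq_iff)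

lemma lie_bracket_anticommute: "lie_bracket g h = - lie_bracket h g"
  by (simp add: lie_bracket_def vec_eq_iff)

text \<open>The classical resonance condition, but without a lower bound on the degree of
  \<open>k\<close>, so that it also governs the linear terms.\<close>

definition resonant :: "complex^'n::finite \<Rightarrow> 'n \<Rightarrow> nat^'n \<Rightarrow> bool"
  where "resonant lam i k \<longleftrightarrow> (\<Sum>j\<in>UNIV. of_nat (k $ j) * lam $ j) = lam $ i"

lemma lie_bracket_diag_eq_0_iff:
  "lie_bracket (lin_vfield (diag_mat lam)) h = 0 \<longleftrightarrow> (\<forall>i k. (h $ i) k \<noteq> 0 \<longrightarrow> resonant lam i k)"
  by (auto simp: vec_eq_iff fun_eq_iff lie_bracket_diag resonant_def)

lemma lin_vfield_axis: "(lin_vfield B $ i) (axis j 1) = B $ i $ j"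
  by (simp add: lin_vfield_def axis_eq_axis)

lemma linear_part_lin_vfield: "linear_part (lin_vfield B) = B"
  by (simp add: linear_part_def lin_vfield_axis[simplified] vec_eq_iff)

lemma total_degree_axis: "total_degree (axis j 1) = 1"
  by (simp add: total_degree_def axis_def)

lemma total_degree_add: "total_degree (k + l) = total_degree k + total_degree l"
  by (simp add: total_degree_def sum.distrib)

lemma lin_vfield_eq_0:
  assumes "total_degree k \<noteq> 1"
  shows "(lin_vfield B $ i) k = 0"
proof -
  have "k \<noteq> axis j 1" for j
    using assms total_degree_axis by metis
  then show ?thesis by (simp add: lin_vfield_def)
qed

lemma mps_euler_add: "mps_euler j l (a + b) k = mps_euler j l a k + mps_euler j l b k"
  by (simp add: mps_euler_def mps_pderiv_def distrib_left)

lemma lie_bracket_lin_vfield_add: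
  "lie_bracket (lin_vfield B) (g + h) = lie_bracket (lin_vfield B) g + lie_bracket (lin_vfield B) h"
  by (simp add: vec_eq_iff fun_eq_iff lie_bracket_lin_vfield mps_euler_add distrib_left sum.distrib)

section \<open>Dimensions and polynomial functions\<close>

text \<open>If \<open>V\<close> lies in a finitely generated span, the exchange lemma compares
  \<open>S\<close> with a basis of \<open>V\<close>; otherwise the dimension is infinite.\<close>

lemma vf_edim_ge_card:
  assumes "finite S" "vf.independent S" "S \<subseteq> V"
  shows "vf_edim V \<ge> enat (card S)"
proof (cases "\<exists>B. finite B \<and> V \<subseteq> vf.span B")
  case True
  then obtain B where B: "finite B" "V \<subseteq> vf.span B" by blast
  obtain b where b: "b \<subseteq> V" "vf.independent b" "V \<subseteq> vf.span b" "card b = vf.dim V"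
    using vf.basis_exists by blast
  then have "finite b"
    using B vf.independent_span_bound by (metis order_trans)
  then have "card S \<le> card b"
    using assms b vf.independent_span_bound by (metis order_trans)
  with True b show ?thesis by (simp add: vf_edim_def)
qed (auto simp: vf_edim_def)

lemma vf_edim_eq_card:
  assumes "finite S" "vf.independent S" "S \<subseteq> V" "V \<subseteq> vf.span S"
  shows "vf_edim V = enat (card S)"
  using assms vf.basis_card_eq_dim[of S V] by (auto simp: vf_edim_def)

section \<open>Polynomial functions and Zariski density\<close>

lemma poly_functions_diff:
  assumes "p \<in> poly_functions" "q \<in> poly_functions"
  shows "(\<lambda>g. p g - q g) \<in> poly_functions"
  using poly_functions.add[OF assms(1) poly_functions.mult[OF poly_functions.const[of "-1"] assms(2)]]
  by simp

lemma poly_functions_sum: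
  "(\<And>x. x \<in> A \<Longrightarrow> F x \<in> poly_functions) \<Longrightarrow> (\<lambda>g. \<Sum>x\<in>A. F x g) \<in> poly_functions"
  by (induction A rule: infinite_finite_induct)
     (auto intro: poly_functions.const poly_functions.add)

lemma poly_functions_prod:
  "(\<And>x. x \<in> A \<Longrightarrow> F x \<in> poly_functions) \<Longrightarrow> (\<lambda>g. \<Prod>x\<in>A. F x g) \<in> poly_functions"
  by (induction A rule: infinite_finite_induct)
     (auto intro: poly_functions.const poly_functions.mult)

lemma poly_functions_det:
  fixes M :: "'n::finite vfield \<Rightarrow> complex^'m^'m::finite"
  assumes "\<And>i j. (\<lambda>g. M g $ i $ j) \<in> poly_functions"
  shows "(\<lambda>g. det (M g)) \<in> poly_functions"
  unfolding det_def
  by (intro poly_functions_sum poly_functions.mult poly_functions_prod poly_functions.const assms)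

lemma poly_functions_coeff: "(\<lambda>g. (g $ i) k) \<in> poly_functions"
proof (rule poly_functions.linear)
  have "vector_space (vf_scale :: complex \<Rightarrow> 'a vfield \<Rightarrow> 'a vfield)" ..
  moreover have "vector_space ((*) :: complex \<Rightarrow> _)"
    by unfold_locales (simp_all add: algebra_simps)
  ultimately show "Vector_Spaces.linear vf_scale (*) (\<lambda>g :: 'a vfield. (g $ i) k)"
    by (auto simp: Vector_Spaces.linear_iff vf_scale_def)
qed

lemma poly_functions_mps_euler: "(\<lambda>g. mps_euler j l (g $ i) k) \<in> poly_functions"
  by (cases "k $ l = 0")
     (simp_all add: mps_euler_def mps_pderiv_def poly_functions.const poly_functions.mult poly_functions_coeff
       del: of_nat_Suc)

definition vf_line :: "'n::finite vfield \<Rightarrow> 'n vfield \<Rightarrow> complex \<Rightarrow> 'n vfield"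
  where "vf_line g h t = g + vf_scale t (h - g)"

text \<open>Restriction to a line leads to univariate polynomials, which form a ring without zero
  divisors.\<close>

lemma poly_functions_on_line:
  assumes "p \<in> poly_functions"
  shows "\<exists>r. \<forall>t. p (vf_line g h t) = poly r t"
  using assms
proof induction
  case (const c)
  show ?case by (intro exI[of _ "[:c:]"]) simp
next
  case (linear p)
  then show ?case
    by (intro exI[of _ "[:p g, p (h - g):]"])
       (simp add: vf_line_def linear_iff_module_hom module_hom.add module_hom.scale)
next
  case (add p q)
  then obtain r s where "\<forall>t. p (vf_line g h t) = poly r t" "\<forall>t. q (vf_line g h t) = poly s t"
    by blast
  then show ?case by (intro exI[of _ "r + s"]) simp
next
  case (mult p q)
  then obtain r s where "\<forall>t. p (vf_line g h t) = poly r t" "\<forall>t. q (vf_line g h t) = poly s t"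
    by blast
  then show ?case by (intro exI[of _ "r * s"]) simp
qed

lemma zariski_open_nonvanishing:
  assumes "p \<in> poly_functions"
  shows "zariski_open_in V {g \<in> V. p g \<noteq> 0}"
  unfolding zariski_open_in_def zariski_closed_in_def
  using assms by (auto intro!: exI[of _ "{p}"])

text \<open>If \<open>q\<close> vanishes wherever \<open>p\<close> does not, then their product
  vanishes on the line from \<open>g\<close> to any \<open>h\<close>. As \<open>p\<close> is nonzero
  at \<open>g\<close>, it is \<open>q\<close> that vanishes on the whole line, in particular at
  \<open>h\<close>.\<close>

lemma zariski_dense_nonvanishing:
  assumes p: "p \<in> poly_functions" and g: "g \<in> V" "p g \<noteq> 0"
    and line: "\<And>h t. h \<in> V \<Longrightarrow> vf_line g h t \<in> V"
  shows "zariski_dense_in V {g \<in> V. p g \<noteq> 0}"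
  unfolding zariski_dense_in_def
proof (intro conjI allI impI)
  fix Z assume Z: "zariski_closed_in V Z \<and> {g \<in> V. p g \<noteq> 0} \<subseteq> Z"
  then obtain P where P: "P \<subseteq> poly_functions" "Z = {g \<in> V. \<forall>p\<in>P. p g = 0}"
    unfolding zariski_closed_in_def by blast
  have "q h = 0" if q: "q \<in> P" and h: "h \<in> V" for q h
  proof -
    obtain r where r: "\<And>t. p (vf_line g h t) = poly r t"
      using poly_functions_on_line[OF p] by blast
    obtain s where s: "\<And>t. q (vf_line g h t) = poly s t"
      using poly_functions_on_line[of q] P(1) q by blast
    \<comment> \<open>A point of the line at which \<open>p\<close> is nonzero lies in
      \<open>Z\<close>, where \<open>q\<close> vanishes.\<close>
    have "poly (r * s) t = 0" for t
      using Z P q line[OF h, of t] by (auto simp flip: r s)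
    then have "r * s = 0"
      using poly_all_0_iff_0 by blast
    moreover have "vf_line g h 0 = g"
      by (simp add: vf_line_def)
    then have "r \<noteq> 0"
      using r[of 0] g by auto
    ultimately have "s = 0" by simp
    moreover have "vf_line g h 1 = h"
      by (simp add: vf_line_def)
    ultimately show ?thesis
      using s[of 1] by simp
  qed
  with P show "Z = V" by blast
qed simp

section \<open>Normal forms\<close>

text \<open>The position of an index \<open>i\<close> in the linear order is
  \<open>card {..<i}\<close>. Each factor \<open>N\<close> moves at least one position to the right,
  which is impossible \<open>CARD('n)\<close> times.\<close>

lemma strictly_upper_imp_nilpotent:
  fixes N :: "complex^'n::{finite,linorder}^'n::{finite,linorder}"
  assumes "strictly_upper N"
  shows "nilpotent_mat N"
proof -
  have *: "card {..<i} + k \<le> card {..<j}" if "(((**) N ^^ k) (mat 1)) $ i $ j \<noteq> 0" for k i j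
    using that
  proof (induction k arbitrary: i)
    case 0
    then show ?case by (simp add: mat_def split: if_splits)
  next
    case (Suc k)
    from Suc.prems obtain l where l: "N $ i $ l * (((**) N ^^ k) (mat 1)) $ l $ j \<noteq> 0"
      unfolding funpow.simps o_apply matrix_matrix_mult_def[of N] vec_lambda_beta
      by (elim sum.not_neutral_contains_not_neutral)
    then have "i < l"
      using assms unfolding strictly_upper_def by (metis mult_zero_left not_less)
    then have "card {..<i} < card {..<l}"
      by (intro psubset_card_mono) auto
    with Suc.IH[of l] l show ?case by auto
  qed
  have "card {..<j} < CARD('n)" for j :: 'n
    by (intro psubset_card_mono) auto
  then have "(((**) N ^^ CARD('n)) (mat 1)) $ i $ j = 0" for i j
    using *[of "CARD('n)" i j] by (metis le_add2 le_trans not_less)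
  then show ?thesis
    unfolding nilpotent_mat_def by (intro exI[of _ "CARD('n)"]) (simp add: vec_eq_iff)
qed

lemma diagonalizable_diag_mat: "diagonalizable (diag_mat lam)"
proof -
  have "invertible (mat 1 :: complex^'a^'a)"
    by (auto simp: invertible_def)
  moreover from this have "matrix_inv (mat 1 :: complex^'a^'a) = mat 1"
    unfolding matrix_inv_def by (intro some_equality) auto
  ultimately show ?thesis
    unfolding diagonalizable_def by (intro exI[of _ "mat 1"] exI[of _ lam]) simp
qed

lemma linear_part_add: "linear_part (f + g) = linear_part f + linear_part g"
  by (simp add: linear_part_def vec_eq_iff)

lemma resonant_axis: "resonant lam i (axis j 1) \<longleftrightarrow> lam $ j = lam $ i"
proof -
  have "(\<Sum>l\<in>UNIV. of_nat (axis j 1 $ l) * lam $ l) = (\<Sum>l\<in>UNIV. if l = j then lam $ j else 0)"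
    by (intro sum.cong) (auto simp: axis_def)
  then show ?thesis by (simp add: resonant_def)
qed

text \<open>Turns the normal form into linear conditions on coefficients. The Jordan-Chevalley
  condition follows from them: strictly upper triangular matrices are nilpotent, and resonance of
  the linear terms means commuting with \<open>diag_mat lam\<close>.\<close>

lemma pdnf_space_iff:
  "g \<in> pdnf_space (diag_mat lam) m \<longleftrightarrow>
    (\<forall>i k. (g $ i) k \<noteq> 0 \<longrightarrow> 1 \<le> total_degree k \<and> total_degree k \<le> m \<and> resonant lam i k) \<and>
    strictly_upper (linear_part g)" (is "?L \<longleftrightarrow> ?R")
proof
  assume ?L
  then have "lie_bracket (lin_vfield (diag_mat lam)) (lin_vfield (diag_mat lam) + g) = 0"
    by (simp add: pdnf_space_def pdnf_def)
  then have "lie_bracket (lin_vfield (diag_mat lam)) g = 0"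
    by (simp add: lie_bracket_lin_vfield_add lie_bracket_self)
  with \<open>?L\<close> show ?R
    by (auto simp: lie_bracket_diag_eq_0_iff pdnf_space_def)
next
  assume R: ?R
  let ?S = "diag_mat lam" and ?N = "linear_part g"
  have comm: "?S ** ?N = ?N ** ?S"
  proof -
    have "lam $ i * ?N $ i $ j = ?N $ i $ j * lam $ j" for i j
      using R resonant_axis[of lam i j] by (auto simp: linear_part_def mult.commute)
    moreover have "(?S ** ?N) $ i $ j = lam $ i * ?N $ i $ j" for i j
    proof -
      have "(?S ** ?N) $ i $ j = (\<Sum>k\<in>UNIV. if k = i then lam $ i * ?N $ i $ j else 0)"
        unfolding matrix_matrix_mult_def vec_lambda_beta by (intro sum.cong) (auto simp: diag_mat_def)
      then show ?thesis by simp
    qed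
    moreover have "(?N ** ?S) $ i $ j = ?N $ i $ j * lam $ j" for i j
    proof -
      have "(?N ** ?S) $ i $ j = (\<Sum>k\<in>UNIV. if k = j then ?N $ i $ j * lam $ j else 0)"
        unfolding matrix_matrix_mult_def vec_lambda_beta by (intro sum.cong) (auto simp: diag_mat_def)
      then show ?thesis by simp
    qed
    ultimately show ?thesis by (simp add: vec_eq_iff)
  qed
  have "((lin_vfield ?S + g) $ i) 0 = 0" for i
    using R lin_vfield_eq_0[of 0 ?S i] by (fastforce simp: total_degree_def)
  moreover have "jordan_chevalley (linear_part (lin_vfield ?S + g)) ?S ?N"
    using R comm by (simp add: jordan_chevalley_def linear_part_add linear_part_lin_vfield
        diagonalizable_diag_mat strictly_upper_imp_nilpotent)
  moreover have "lie_bracket (lin_vfield ?S) g = 0"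
    using R by (auto simp: lie_bracket_diag_eq_0_iff)
  ultimately have "pdnf ?S (lin_vfield ?S + g)"
    using R by (auto simp: pdnf_def lie_bracket_lin_vfield_add lie_bracket_self)
  with R show ?L by (simp add: pdnf_space_def)
qed

lemma vf_line_in_pdnf_space:
  assumes "g \<in> pdnf_space (diag_mat lam) m" "h \<in> pdnf_space (diag_mat lam) m"
  shows "vf_line g h t \<in> pdnf_space (diag_mat lam) m"
proof -
  have *: "(vf_line g h t $ i) k = (g $ i) k + t * ((h $ i) k - (g $ i) k)" for i k
    by (simp add: vf_line_def vf_scale_def)
  then have "(g $ i) k \<noteq> 0 \<or> (h $ i) k \<noteq> 0" if "(vf_line g h t $ i) k \<noteq> 0" for i k
    using that by auto
  moreover have "strictly_upper (linear_part (vf_line g h t))"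
    using assms by (simp add: pdnf_space_iff strictly_upper_def linear_part_def *)
  ultimately show ?thesis
    using assms unfolding pdnf_space_iff by blast
qed

section \<open>Rational relations\<close>

text \<open>A rational basis is chosen among the eigenvalues themselves; \<open>R\<close> holds the
  coordinates of all eigenvalues in it.\<close>

lemma rational_index_basis:
  fixes lam :: "complex^'n::finite"
  obtains I :: "'n set" and R :: "'n \<Rightarrow> 'n \<Rightarrow> rat"
  where "card I = rat_rank lam"
    and "\<And>i b. i \<in> I \<Longrightarrow> b \<in> I \<Longrightarrow> R i b = (if i = b then 1 else 0)"
    and "\<And>i. lam $ i = (\<Sum>b\<in>I. of_rat (R i b) * lam $ b)"
    and "\<And>(u :: 'n \<Rightarrow> rat) b. (\<Sum>b\<in>I. of_rat (u b) * lam $ b) = 0 \<Longrightarrow> b \<in> I \<Longrightarrow> u b = 0"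
proof -
  let ?A = "range (\<lambda>i. lam $ i)"
  obtain B where B: "B \<subseteq> ?A" "rat_vs.independent B" "?A \<subseteq> rat_vs.span B" "card B = rat_vs.dim ?A"
    using rat_vs.basis_exists by blast
  have finB: "finite B"
    using B by (metis finite finite_imageI finite_subset)
  \<comment> \<open>Eigenvalues may repeat; \<open>I\<close> takes one index for each basis
    element.\<close>
  obtain I where I: "inj_on (($) lam) I" "B = ($) lam ` I"
    using B(1) by (metis subset_image_inj)
  define R where "R i b = rat_vs.representation B (lam $ i) (lam $ b)" for i b
  show ?thesis
  proof (rule that[of I R])
    show "card I = rat_rank lam"
      using B I by (simp add: rat_rank_def card_image)
  next
    fix i b assume "i \<in> I" "b \<in> I"
    then show "R i b = (if i = b then 1 else 0)"
      using B I by (auto simp: R_def rat_vs.representation_basis dest: inj_onD)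
  next
    fix i
    have "(\<Sum>b\<in>B. of_rat (rat_vs.representation B (lam $ i) b) * b) = lam $ i"
      using B finB by (intro rat_vs.sum_representation_eq) auto
    then show "lam $ i = (\<Sum>b\<in>I. of_rat (R i b) * lam $ b)"
      using I by (simp add: R_def sum.reindex)
  next
    fix u :: "'n \<Rightarrow> rat" and b
    assume u: "(\<Sum>b\<in>I. of_rat (u b) * lam $ b) = 0" and b: "b \<in> I"
    define w where "w x = u (the_inv_into I (($) lam) x)" for x
    have "(\<Sum>x\<in>B. of_rat (w x) * x) = (\<Sum>b\<in>I. of_rat (u b) * lam $ b)"
      unfolding I(2) w_def using I(1) by (simp add: sum.reindex the_inv_into_f_f)
    with u have "\<forall>x\<in>B. w x = 0"
      using B(2) finB by (simp add: rat_vs.dependent_finite) blast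
    moreover have "w (lam $ b) = u b"
      using I(1) b by (simp add: w_def the_inv_into_f_f)
    ultimately show "u b = 0"
      using I(2) b by auto
  qed
qed

lemma common_denominator:
  fixes A :: "rat set"
  assumes "finite A"
  shows "\<exists>D::nat. D > 0 \<and> (\<forall>x\<in>A. of_nat D * x \<in> \<int>)"
  using assms
proof induction
  case empty
  show ?case by (intro exI[of _ 1]) simp
next
  case (insert x A)
  then obtain D :: nat where D: "D > 0" "\<forall>x\<in>A. of_nat D * x \<in> \<int>" by blast
  obtain p q where x: "x = of_int p / of_int q" "q > 0"
    by (metis quotient_of_div quotient_of_denom_pos surj_pair)
  have "of_nat (D * nat q) * x = of_nat D * of_int p"
    using x by simp
  moreover have "of_nat (D * nat q) * y \<in> \<int>" if "y \<in> A" for y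
  proof -
    have "of_nat (D * nat q) * y = of_nat (nat q) * (of_nat D * y)" by simp
    then show ?thesis using D that by (metis Ints_mult Ints_of_nat)
  qed
  ultimately show ?case
    using D x by (intro exI[of _ "D * nat q"]) auto
qed

text \<open>The relations \<open>a\<^sub>i\<close> are \<open>D (e\<^sub>i - \<Sum>\<^sub>b R\<^sub>i\<^sub>b e\<^sub>b)\<close>, shifted by a multiple of the positive
  relation \<open>d\<close> so as to have positive entries.\<close>

lemma positive_relations:
  fixes lam :: "complex^'n::finite" and d :: "nat^'n"
  assumes d: "\<And>i. d $ i > 0" "(\<Sum>j\<in>UNIV. of_nat (d $ j) * lam $ j) = 0"
    and R: "\<And>i. lam $ i = (\<Sum>b\<in>I. of_rat (R i b) * lam $ b)"
  obtains a :: "'n \<Rightarrow> nat^'n"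
  where "\<And>i j. d $ j < a i $ j"
    and "\<And>i. (\<Sum>j\<in>UNIV. of_nat (a i $ j) * lam $ j) = 0"
    and "\<And>v :: complex^'n. (\<And>i. i \<in> I \<Longrightarrow> v $ i = 0) \<Longrightarrow>
      (\<And>i. i \<notin> I \<Longrightarrow> (\<Sum>j\<in>UNIV. of_nat (a i $ j) * v $ j) = 0) \<Longrightarrow> v = 0"
proof -
  obtain D :: nat where D: "D > 0" "\<And>i j. of_nat D * R i j \<in> \<int>"
    using common_denominator[of "range (\<lambda>(i, j). R i j)"] by auto
  have "\<exists>r :: int. of_int r = of_nat D * ((if i = j then 1 else 0) - (if j \<in> I then R i j else 0))" for i j
  proof -
    have "of_nat D * ((if i = j then 1 else 0) - (if j \<in> I then R i j else 0)) \<in> \<int>"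
      using D(2)[of i j] by (auto simp: right_diff_distrib)
    then show ?thesis by (metis Ints_cases)
  qed
  then obtain r :: "'n \<Rightarrow> 'n \<Rightarrow> int"
    where r: "\<And>i j. of_int (r i j) = of_nat D * ((if i = j then 1 else 0) - (if j \<in> I then R i j else 0))"
    by metis
  \<comment> \<open>Stated for arbitrary \<open>v\<close>: \<open>lam\<close> gives the relation
    itself, and a general \<open>v\<close> the completeness of the relations.\<close>
  have r_sum: "(\<Sum>j\<in>UNIV. of_int (r i j) * v j) = of_nat D * (v i - (\<Sum>b\<in>I. of_rat (R i b) * v b))"
    for i and v :: "'n \<Rightarrow> complex"
  proof -
    have "of_int (r i j) * v j = of_nat D * ((if j = i then v i else 0) -
        (if j \<in> I then of_rat (R i j) * v j else 0))" for j
    proof -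
      have "(of_int (r i j) :: complex) = of_rat (of_int (r i j))" by simp
      also have "\<dots> = of_nat D * ((if i = j then 1 else 0) - (if j \<in> I then of_rat (R i j) else 0))"
        unfolding r by (simp add: of_rat_mult of_rat_diff)
      finally show ?thesis
        by (simp only: mult.assoc) (simp add: left_diff_distrib)
    qed
    then show ?thesis
      by (simp add: sum_subtractf sum.If_cases flip: sum_distrib_left)
  qed
  \<comment> \<open>As each \<open>d $ j\<close> is at least 1, the summands of \<open>c\<close>
    absorb every \<open>r i j\<close> and still leave \<open>2 * d $ j\<close>.\<close>
  define c where "c = nat (2 + (\<Sum>i\<in>UNIV. \<Sum>j\<in>UNIV. \<bar>r i j\<bar>))"
  define a :: "'n \<Rightarrow> nat^'n" where "a i = (\<chi> j. nat (r i j + int (c * d $ j)))" for i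
  have large: "int (d $ j) < r i j + int (c * d $ j)" for i j
  proof -
    have "\<bar>r i j\<bar> \<le> (\<Sum>j\<in>UNIV. \<bar>r i j\<bar>)"
      by (intro member_le_sum) auto
    also have "\<dots> \<le> (\<Sum>i\<in>UNIV. \<Sum>j\<in>UNIV. \<bar>r i j\<bar>)"
      by (rule member_le_sum) (auto intro: sum_nonneg)
    finally have "int c \<ge> 2 + \<bar>r i j\<bar>"
      by (simp add: c_def)
    then have "int c * int (d $ j) \<ge> (2 + \<bar>r i j\<bar>) * int (d $ j)"
      by (intro mult_right_mono) auto
    moreover have "\<bar>r i j\<bar> * int (d $ j) \<ge> \<bar>r i j\<bar> * 1"
      using d(1)[of j] by (intro mult_left_mono) auto
    moreover have "int (d $ j) > 0" using d(1)[of j] by simp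
    ultimately show ?thesis
      by (simp add: distrib_right)
  qed
  have a: "of_nat (a i $ j) = (of_int (r i j) + of_nat c * of_nat (d $ j) :: complex)" for i j
  proof -
    have "int (a i $ j) = r i j + int (c * d $ j)"
      using large[of j i] by (simp add: a_def)
    then have "(of_int (int (a i $ j)) :: complex) = of_int (r i j + int (c * d $ j))" by simp
    then show ?thesis by simp
  qed
  have a_sum: "(\<Sum>j\<in>UNIV. of_nat (a i $ j) * v j) =
      of_nat D * (v i - (\<Sum>b\<in>I. of_rat (R i b) * v b)) + of_nat c * (\<Sum>j\<in>UNIV. of_nat (d $ j) * v j)"
    for i and v :: "'n \<Rightarrow> complex"
    by (simp add: a distrib_right sum.distrib r_sum sum_distrib_left mult.assoc)
  show ?thesis
  proof (rule that[of a])
    show "d $ j < a i $ j" for i j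
      using large[of j i] by (simp add: a_def zless_nat_eq_int_zless)
    show "(\<Sum>j\<in>UNIV. of_nat (a i $ j) * lam $ j) = 0" for i
      using a_sum[of i "($) lam"] R[of i] d(2) by simp
  next
    fix v :: "complex^'n"
    assume vI: "\<And>i. i \<in> I \<Longrightarrow> v $ i = 0"
      and va: "\<And>i. i \<notin> I \<Longrightarrow> (\<Sum>j\<in>UNIV. of_nat (a i $ j) * v $ j) = 0"
    \<comment> \<open>The shift by \<open>d\<close> enters all equations through this one number,
      which determines \<open>v\<close> outside \<open>I\<close>.\<close>
    define s where "s = (\<Sum>j\<in>UNIV. of_nat (d $ j) * v $ j)"
    have Dv: "of_nat D * v $ i = - of_nat c * s" if "i \<notin> I" for i
      using va[OF that] a_sum[of i "($) v"] vI by (simp add: s_def add_eq_0_iff)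
    \<comment> \<open>Inserting the values of \<open>v\<close> back into \<open>s\<close> gives a
      positive integer times \<open>s\<close> equal to 0.\<close>
    have "of_nat D * s = (\<Sum>j\<in>UNIV. of_nat (d $ j) * (of_nat D * v $ j))"
      by (simp add: s_def sum_distrib_left mult_ac)
    also have "\<dots> = (\<Sum>j\<in>-I. of_nat (d $ j) * (of_nat D * v $ j))"
      using vI by (intro sum.mono_neutral_right) auto
    also have "\<dots> = (\<Sum>j\<in>-I. of_nat (d $ j) * (- of_nat c * s))"
      using Dv by (intro sum.cong) auto
    also have "\<dots> = - of_nat (c * (\<Sum>j\<in>-I. d $ j)) * s"
      by (simp add: sum_distrib_left sum_distrib_right sum_negf mult_ac)
    finally have "of_nat (D + c * (\<Sum>j\<in>-I. d $ j)) * s = 0"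
      by (simp add: distrib_right)
    then have "s = 0"
      using D(1) by (simp only: mult_eq_0_iff of_nat_eq_0_iff) simp
    then have "v $ i = 0" for i
      using Dv[of i] vI[of i] D(1) by (cases "i \<in> I") auto
    then show "v = 0" by (simp add: vec_eq_iff)
  qed
qed

section \<open>Generic triviality of the linear centralizer\<close>

lemma det_nz_iff_kernel:
  fixes A :: "'a::field^'n^'n"
  shows "det A \<noteq> 0 \<longleftrightarrow> (\<forall>x. A *v x = 0 \<longrightarrow> x = 0)"
  by (metis invertible_det_nz invertible_left_inverse matrix_left_invertible_ker)

lemma sum_add_axis:
  "(\<Sum>j\<in>UNIV. of_nat ((k + axis i 1) $ j) * mu $ j) = (\<Sum>j\<in>UNIV. of_nat (k $ j) * mu $ j) + mu $ i"
  for mu :: "complex^'n::finite"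
proof -
  have "(\<Sum>j\<in>UNIV. of_nat ((k + axis i 1) $ j) * mu $ j) =
    (\<Sum>j\<in>UNIV. of_nat (k $ j) * mu $ j + (if j = i then mu $ i else 0))"
    by (intro sum.cong) (auto simp: axis_def algebra_simps)
  then show ?thesis by (simp add: sum.distrib)
qed

text \<open>The index \<open>i\<close> drops out: the product of \<open>x^k\<close> with the Euler
  field is resonant in all components as soon as \<open>x^k\<close> is invariant.\<close>

lemma resonant_add_axis:
  "resonant lam i (k + axis i 1) \<longleftrightarrow> (\<Sum>j\<in>UNIV. of_nat (k $ j) * lam $ j) = 0"
  unfolding resonant_def sum_add_axis by simp

lemma lie_bracket_lin_vfield_diff:
  "lie_bracket (lin_vfield (A - B)) h = lie_bracket (lin_vfield A) h - lie_bracket (lin_vfield B) h"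
  by (simp add: vec_eq_iff fun_eq_iff lie_bracket_lin_vfield left_diff_distrib sum_subtractf)

text \<open>Linear fields are closed under the bracket. Hence \<open>A_s\<close> does not contribute
  to the test system, whose exponents have degree at least 2.\<close>

lemma lie_bracket_linear_eq_0:
  assumes "total_degree k \<noteq> 1"
  shows "(lie_bracket (lin_vfield B) (lin_vfield A) $ i) k = 0"
proof -
  have "mps_euler j l (lin_vfield A $ i) k = 0" for j l
  proof (cases "k $ l = 0")
    case False
    then have "k - axis l 1 + axis l 1 = k"
      by (auto simp: vec_eq_iff axis_def)
    then have "total_degree (k - axis l 1 + axis j 1) \<noteq> 1"
      using assms by (metis total_degree_add total_degree_axis)
    then have "(lin_vfield A $ i) (k - axis l 1 + axis j 1) = 0"
      by (rule lin_vfield_eq_0)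
    then show ?thesis by (simp add: mps_euler_def mps_pderiv_def)
  qed (simp add: mps_euler_def)
  then show ?thesis
    using assms by (simp add: lie_bracket_lin_vfield lin_vfield_eq_0)
qed

text \<open>The field \<open>(\<Sum>\<^sub>a x\<^sup>a) (x\<^sub>1, \<dots>, x\<^sub>n)\<close>, with \<open>a\<close> ranging over \<open>K\<close>.\<close>

definition radial_field :: "(nat^'n) set \<Rightarrow> 'n::finite vfield"
  where "radial_field K = (\<chi> i. (\<lambda>k. if \<exists>a\<in>K. k = a + axis i 1 then 1 else 0))"

text \<open>\<open>I\<close> and \<open>R\<close> come from \<open>rational_index_basis\<close>, and
  \<open>a\<close> from \<open>positive_relations\<close>. The strict bound \<open>a_gt\<close>
  makes \<open>x^d\<close> the monomial of least degree.\<close>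

locale relation_basis =
  fixes lam :: "(complex, 'n::{finite,linorder}) vec"
    and d :: "(nat, 'n) vec" and I :: "'n set" and R :: "'n \<Rightarrow> 'n \<Rightarrow> rat" and a :: "'n \<Rightarrow> (nat, 'n) vec"
  assumes d_pos: "\<And>i. d $ i > 0"
    and d_rel: "(\<Sum>j\<in>UNIV. of_nat (d $ j) * lam $ j) = 0"
    and card_I: "card I = rat_rank lam"
    and R_I: "\<And>i b. i \<in> I \<Longrightarrow> b \<in> I \<Longrightarrow> R i b = (if i = b then 1 else 0)"
    and R_rep: "\<And>i. lam $ i = (\<Sum>b\<in>I. of_rat (R i b) * lam $ b)"
    and I_indep: "\<And>(u :: 'n \<Rightarrow> rat) b. (\<Sum>b\<in>I. of_rat (u b) * lam $ b) = 0 \<Longrightarrow> b \<in> I \<Longrightarrow> u b = 0"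
    and a_gt: "\<And>i j. d $ j < a i $ j"
    and a_rel: "\<And>i. (\<Sum>j\<in>UNIV. of_nat (a i $ j) * lam $ j) = 0"
    and a_complete: "\<And>v :: (complex, 'n) vec. (\<And>i. i \<in> I \<Longrightarrow> v $ i = 0) \<Longrightarrow>
      (\<And>i. i \<notin> I \<Longrightarrow> (\<Sum>j\<in>UNIV. of_nat (a i $ j) * v $ j) = 0) \<Longrightarrow> v = 0"
begin

text \<open>The basis eigenvalues \<open>lam $ b\<close> are replaced by arbitrary complex numbers
  \<open>c b\<close>, while the rational coordinates \<open>R\<close> are kept.\<close>

definition rat_diag :: "('n \<Rightarrow> complex) \<Rightarrow> (complex, 'n) vec"
  where "rat_diag c = (\<chi> i. \<Sum>b\<in>I. c b * of_rat (R i b))"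

lemma rat_diag_I: "b \<in> I \<Longrightarrow> rat_diag c $ b = c b"
proof -
  assume "b \<in> I"
  then have "rat_diag c $ b = (\<Sum>x\<in>I. if x = b then c b else 0)"
    unfolding rat_diag_def vec_lambda_beta by (intro sum.cong) (auto simp: R_I)
  with \<open>b \<in> I\<close> show ?thesis by simp
qed

text \<open>A resonance of \<open>lam\<close> is an integer relation. By rational independence it
  holds for each column of \<open>R\<close> separately, and so for every complex combination of the
  columns.\<close>

lemma resonant_rat_diag:
  assumes "resonant lam i k"
  shows "resonant (rat_diag c) i k"
proof -
  define u where "u b = (\<Sum>j\<in>UNIV. of_nat (k $ j) * R j b) - R i b" for b
  have "(\<Sum>b\<in>I. of_rat (u b) * lam $ b) =
      (\<Sum>b\<in>I. \<Sum>j\<in>UNIV. of_nat (k $ j) * (of_rat (R j b) * lam $ b)) - (\<Sum>b\<in>I. of_rat (R i b) * lam $ b)"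
    by (simp add: u_def of_rat_diff of_rat_sum of_rat_mult left_diff_distrib sum_subtractf
        sum_distrib_right mult.assoc)
  also have "(\<Sum>b\<in>I. \<Sum>j\<in>UNIV. of_nat (k $ j) * (of_rat (R j b) * lam $ b)) =
      (\<Sum>j\<in>UNIV. of_nat (k $ j) * (\<Sum>b\<in>I. of_rat (R j b) * lam $ b))"
    by (subst sum.swap) (simp add: sum_distrib_left)
  also have "\<dots> - (\<Sum>b\<in>I. of_rat (R i b) * lam $ b) = 0"
    using assms by (simp add: resonant_def flip: R_rep)
  finally have u0: "u b = 0" if "b \<in> I" for b
    using I_indep that by blast
  then have u: "(\<Sum>j\<in>UNIV. of_nat (k $ j) * of_rat (R j b)) = (of_rat (R i b) :: complex)" if "b \<in> I" for b
  proof -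
    have "(\<Sum>j\<in>UNIV. of_nat (k $ j) * of_rat (R j b)) = (of_rat (\<Sum>j\<in>UNIV. of_nat (k $ j) * R j b) :: complex)"
      by (simp add: of_rat_sum of_rat_mult)
    with u0[OF that] show ?thesis by (simp add: u_def)
  qed
  have "(\<Sum>j\<in>UNIV. of_nat (k $ j) * rat_diag c $ j) =
      (\<Sum>b\<in>I. c b * (\<Sum>j\<in>UNIV. of_nat (k $ j) * of_rat (R j b)))"
    unfolding rat_diag_def vec_lambda_beta sum_distrib_left
    by (subst sum.swap) (simp add: mult_ac)
  also have "\<dots> = rat_diag c $ i"
    using u by (simp add: rat_diag_def)
  finally show ?thesis by (simp add: resonant_def)
qed

definition diag_basis :: "'n \<Rightarrow> 'n vfield"
  where "diag_basis b = lin_vfield (diag_mat (rat_diag (\<lambda>x. if x = b then 1 else 0)))"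

lemma inj_on_diag_basis: "inj_on diag_basis I"
proof
  fix b b' assume *: "b \<in> I" "b' \<in> I" "diag_basis b = diag_basis b'"
  have "linear_part (diag_basis b) $ b $ b = linear_part (diag_basis b') $ b $ b"
    using * by simp
  with *(1,2) show "b = b'"
    by (simp add: diag_basis_def linear_part_lin_vfield diag_mat_def rat_diag_I split: if_splits)
qed

lemma lin_rat_diag: "lin_vfield (diag_mat (rat_diag c)) = (\<Sum>b\<in>I. vf_scale (c b) (diag_basis b))"
proof -
  have "(lin_vfield (diag_mat (rat_diag c)) $ i) k = ((\<Sum>b\<in>I. vf_scale (c b) (diag_basis b)) $ i) k" for i k
  proof -
    have diag: "(lin_vfield (diag_mat mu) $ i) k = (if k = axis i 1 then mu $ i else 0)" for mu
    proof -
      have "(lin_vfield (diag_mat mu) $ i) k = (\<Sum>j\<in>UNIV. if j = i then (if k = axis i 1 then mu $ i else 0) else 0)"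
        unfolding lin_vfield_def vec_lambda_beta by (intro sum.cong) (auto simp: diag_mat_def)
      then show ?thesis by simp
    qed
    have single: "rat_diag (\<lambda>x. if x = b then 1 else 0) $ i = of_rat (R i b)" if "b \<in> I" for b
    proof -
      have "rat_diag (\<lambda>x. if x = b then 1 else 0) $ i = (\<Sum>x\<in>I. if x = b then of_rat (R i b) else 0)"
        unfolding rat_diag_def vec_lambda_beta by (intro sum.cong) auto
      with that show ?thesis by simp
    qed
    have "((\<Sum>b\<in>I. vf_scale (c b) (diag_basis b)) $ i) k =
        (\<Sum>b\<in>I. c b * (if k = axis i 1 then of_rat (R i b) else 0))"
      unfolding sum_component sum_fun_apply
      by (intro sum.cong) (auto simp: vf_scale_def diag_basis_def diag single)
    then show ?thesis by (simp add: diag) (simp add: rat_diag_def)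
  qed
  then show ?thesis by (simp add: vec_eq_iff fun_eq_iff)
qed

text \<open>The diagonal entries at \<open>I\<close> recover the coefficients of a
  combination.\<close>

lemma independent_diag_basis: "vf.independent (diag_basis ` I)"
proof -
  have "u v = 0" if u: "(\<Sum>v\<in>diag_basis ` I. vf_scale (u v) v) = 0" and v: "v \<in> diag_basis ` I" for u v
  proof -
    obtain b where b: "b \<in> I" "v = diag_basis b" using v by blast
    have "lin_vfield (diag_mat (rat_diag (\<lambda>b. u (diag_basis b)))) = 0"
      using u inj_on_diag_basis by (simp add: lin_rat_diag sum.reindex)
    then have "linear_part (lin_vfield (diag_mat (rat_diag (\<lambda>b. u (diag_basis b))))) $ b $ b = 0"
      by (simp add: linear_part_def)
    with b show ?thesis
      by (simp add: linear_part_lin_vfield diag_mat_def rat_diag_I)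
  qed
  then show ?thesis
    by (subst vf.dependent_finite) auto
qed

lemma card_diag_basis: "card (diag_basis ` I) = rat_rank lam"
  using inj_on_diag_basis card_I by (simp add: card_image)

section \<open>Lower bounds for the centralizer\<close>

lemma rat_diag_in_centralizer:
  assumes "lie_bracket (lin_vfield (diag_mat lam)) f = 0"
  shows "lin_vfield (diag_mat (rat_diag c)) \<in> centralizer f"
  using assms resonant_rat_diag by (auto simp: centralizer_def lie_bracket_diag_eq_0_iff)

lemma diag_basis_in_centralizer:
  assumes "lie_bracket (lin_vfield (diag_mat lam)) f = 0"
  shows "diag_basis ` I \<subseteq> centralizer f \<inter> range lin_vfield"
  using rat_diag_in_centralizer[OF assms] by (auto simp: diag_basis_def)

text \<open>Ensures that a non-diagonal element of the centralizer is independent of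
  \<open>diag_basis\<close>.\<close>

lemma span_diag_basis: "vf.span (diag_basis ` I) \<subseteq> range (\<lambda>mu. lin_vfield (diag_mat mu))"
proof
  fix x assume "x \<in> vf.span (diag_basis ` I)"
  then obtain u where "x = (\<Sum>v\<in>diag_basis ` I. vf_scale (u v) v)"
    by (subst (asm) vf.span_finite) auto
  then have "x = lin_vfield (diag_mat (rat_diag (\<lambda>b. u (diag_basis b))))"
    using inj_on_diag_basis by (simp add: lin_rat_diag sum.reindex)
  then show "x \<in> range (\<lambda>mu. lin_vfield (diag_mat mu))" by blast
qed

text \<open>A normal form is itself in its centralizer; if it is diagonal, then \<open>x\<^sup>d (x\<^sub>1, \<dots>, x\<^sub>n)\<close>
  serves instead.\<close>

lemma centralizer_not_diagonal:
  assumes f: "pdnf (diag_mat lam) f"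
  shows "\<exists>x\<in>centralizer f. x \<notin> range (\<lambda>mu. lin_vfield (diag_mat mu))"
proof (cases "f \<in> range (\<lambda>mu. lin_vfield (diag_mat mu))")
  case True
  then obtain mu where mu: "f = lin_vfield (diag_mat mu)" by blast
  obtain N where N: "linear_part f = diag_mat lam + N" "strictly_upper N"
    using f by (auto simp: pdnf_def jordan_chevalley_def)
  have "diag_mat mu = diag_mat lam + N"
    using N(1) by (simp add: mu linear_part_lin_vfield)
  \<comment> \<open>A strictly upper triangular \<open>N\<close> has zero diagonal, so comparing
    diagonals identifies \<open>mu\<close> with \<open>lam\<close>.\<close>
  then have "diag_mat mu $ i $ i = (diag_mat lam + N) $ i $ i" for i by simp
  then have "mu $ i = lam $ i" for i
    using N(2) by (simp add: diag_mat_def strictly_upper_def)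
  then have "mu = lam"
    by (simp add: vec_eq_iff)
  then have f_eq: "f = lin_vfield (diag_mat lam)"
    using mu by simp
  have "lie_bracket (lin_vfield (diag_mat lam)) (radial_field {d}) = 0"
    using d_rel resonant_add_axis by (auto simp: lie_bracket_diag_eq_0_iff radial_field_def)
  then have "radial_field {d} \<in> centralizer f"
    by (simp add: centralizer_def f_eq lie_bracket_anticommute[of "radial_field _"])
  moreover have "radial_field {d} \<noteq> lin_vfield B" for B
  proof
    assume *: "radial_field {d} = lin_vfield B"
    \<comment> \<open>Any index will do: \<open>x^d x_i\<close> has degree at least 2, so its
      coefficient in a linear field is 0.\<close>
    fix i :: 'n
    have "0 < d $ i" by (rule d_pos)
    also have "d $ i \<le> total_degree d"
      unfolding total_degree_def by (intro member_le_sum) auto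
    finally have "total_degree (d + axis i 1) \<noteq> 1"
      by (simp add: total_degree_add total_degree_axis[simplified])
    then have "(radial_field {d} $ i) (d + axis i 1) = 0"
      unfolding * by (rule lin_vfield_eq_0)
    then show False by (simp add: radial_field_def)
  qed
  ultimately show ?thesis by blast
next
  case False
  then show ?thesis
    by (intro bexI[of _ f]) (auto simp: centralizer_def lie_bracket_self)
qed

lemma edim_centralizer_ge:
  assumes f: "pdnf (diag_mat lam) f"
  shows "vf_edim (centralizer f \<inter> range lin_vfield) \<ge> enat (rat_rank lam)"
    and "vf_edim (centralizer f) \<ge> enat (rat_rank lam + 1)"
proof -
  have comm: "lie_bracket (lin_vfield (diag_mat lam)) f = 0"
    using f by (simp add: pdnf_def)
  note sub = diag_basis_in_centralizer[OF comm]
  show "vf_edim (centralizer f \<inter> range lin_vfield) \<ge> enat (rat_rank lam)"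
    using vf_edim_ge_card[OF _ independent_diag_basis sub] card_diag_basis by simp
  obtain x where x: "x \<in> centralizer f" "x \<notin> vf.span (diag_basis ` I)"
    using centralizer_not_diagonal[OF f] span_diag_basis by blast
  then have "x \<notin> diag_basis ` I"
    using vf.span_base by blast
  then have card: "card (insert x (diag_basis ` I)) = rat_rank lam + 1"
    by (simp add: card_diag_basis)
  have "vf.independent (insert x (diag_basis ` I))"
    using x independent_diag_basis by (intro vf.independent_insertI)
  moreover have "insert x (diag_basis ` I) \<subseteq> centralizer f"
    using x sub by blast
  ultimately have "vf_edim (centralizer f) \<ge> enat (card (insert x (diag_basis ` I)))"
    by (rule vf_edim_ge_card[rotated]) (intro finite.insertI finite_imageI finite)
  then show "vf_edim (centralizer f) \<ge> enat (rat_rank lam + 1)"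
    unfolding card .
qed

text \<open>The square linear system in the entries of \<open>B\<close> that consists of \<open>n\<^sup>2 - card I\<close> of the
  coefficients of \<open>[B, g]\<close> and of the diagonal entries of \<open>B\<close> at \<open>I\<close>.\<close>

definition test_exponent :: "'n \<Rightarrow> 'n \<Rightarrow> (nat, 'n) vec"
  where "test_exponent i j = (if i = j then a i + axis i 1 else d + axis j 1)"

text \<open>Column \<open>(p, q)\<close> belongs to the unknown \<open>B $ p $ q\<close>. The rows
  at \<open>(i, i)\<close> with \<open>i\<close> in \<open>I\<close> remove the known solutions
  \<open>rat_diag\<close>, so that the determinant can be nonzero.\<close>

definition test_matrix :: "'n vfield \<Rightarrow> complex^('n \<times> 'n)^('n \<times> 'n)"
  where "test_matrix g = vec_lambda (\<lambda>(i, j). vec_lambda (\<lambda>(p, q).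
    if i = j \<and> i \<in> I then (if p = i \<and> q = i then 1 else 0)
    else mps_euler p q (g $ i) (test_exponent i j) - (if p = i then (g $ q) (test_exponent i j) else 0)))"

lemma test_matrix_vec:
  "(test_matrix g *v vec_lambda (\<lambda>(p, q). B $ p $ q)) $ (i, j) =
    (if i = j \<and> i \<in> I then B $ i $ i else (lie_bracket (lin_vfield B) g $ i) (test_exponent i j))"
proof (cases "i = j \<and> i \<in> I")
  case True
  then have "(test_matrix g *v vec_lambda (\<lambda>(p, q). B $ p $ q)) $ (i, j) =
      (\<Sum>x\<in>UNIV. if x = (i, i) then B $ i $ i else 0)"
    unfolding matrix_vector_mult_def vec_lambda_beta test_matrix_def
    by (intro sum.cong) (auto split: if_splits)
  then show ?thesis
    unfolding if_P[OF True] by simp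
next
  case False
  let ?k = "test_exponent i j"
  have "(test_matrix g *v vec_lambda (\<lambda>(p, q). B $ p $ q)) $ (i, j) =
      (\<Sum>x\<in>UNIV. case x of (p, q) \<Rightarrow>
        B $ p $ q * mps_euler p q (g $ i) ?k - (if p = i then B $ i $ q * (g $ q) ?k else 0))"
    unfolding matrix_vector_mult_def vec_lambda_beta test_matrix_def
    using False by (intro sum.cong) (auto simp: algebra_simps)
  also have "\<dots> = (\<Sum>p\<in>UNIV. \<Sum>q\<in>UNIV.
        B $ p $ q * mps_euler p q (g $ i) ?k - (if p = i then B $ i $ q * (g $ q) ?k else 0))"
    by (simp add: sum.cartesian_product)
  also have "\<dots> = (\<Sum>p\<in>UNIV. \<Sum>q\<in>UNIV. B $ p $ q * mps_euler p q (g $ i) ?k) -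
      (\<Sum>p\<in>UNIV. if p = i then \<Sum>q\<in>UNIV. B $ i $ q * (g $ q) ?k else 0)"
    unfolding sum_subtractf
    by (intro arg_cong2[where f = minus] refl sum.cong) (auto intro: sum.neutral)
  finally show ?thesis
    using False by (auto simp: lie_bracket_lin_vfield)
qed

lemma poly_functions_test_matrix: "(\<lambda>g. det (test_matrix g)) \<in> poly_functions"
proof (rule poly_functions_det)
  fix x y :: "'n \<times> 'n"
  obtain i j p q where xy: "x = (i, j)" "y = (p, q)" by fastforce
  show "(\<lambda>g. test_matrix g $ x $ y) \<in> poly_functions"
  proof (cases "i = j \<and> i \<in> I")
    case True
    have "(\<lambda>g. test_matrix g $ x $ y) = (\<lambda>g. if p = i \<and> q = i then 1 else 0)"
      unfolding xy test_matrix_def vec_lambda_beta prod.case if_P[OF True] by (rule refl)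
    then show ?thesis
      by (simp only: poly_functions.const)
  next
    case False
    have "(\<lambda>g. test_matrix g $ x $ y) = (\<lambda>g. mps_euler p q (g $ i) (test_exponent i j) -
        (if p = i then (g $ q) (test_exponent i j) else 0))"
      using False by (auto simp: xy test_matrix_def)
    also have "\<dots> \<in> poly_functions"
      by (cases "p = i") (simp_all add: poly_functions_diff poly_functions_mps_euler poly_functions_coeff poly_functions.const)
    finally show ?thesis .
  qed
qed

section \<open>A normal form with a nonsingular test system\<close>

definition model :: "'n vfield"
  where "model = radial_field (insert d (range a))"

lemma degree_a: "total_degree d < total_degree (a i)"
  unfolding total_degree_def by (intro sum_strict_mono) (auto simp: a_gt)

text \<open>The monomials \<open>x^a\<close> have larger degree than \<open>x^d\<close>, so only the
  latter is visible in this degree.\<close>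

lemma model_coeff:
  assumes "total_degree k = total_degree d + 1"
  shows "(model $ i) k = (if k = d + axis i 1 then 1 else 0)"
proof -
  have "k \<noteq> a l + axis i 1" for l
    using assms degree_a[of l] by (auto simp: total_degree_add total_degree_axis[simplified])
  then show ?thesis by (auto simp: model_def radial_field_def)
qed

text \<open>Applying \<open>x_j\<close> times the \<open>i\<close>-th partial derivative to
  \<open>x^d x_i\<close> contributes \<open>d $ i + 1\<close> times \<open>B $ i $ j\<close>; the
  term \<open>B h\<close> of the bracket takes one copy away. As \<open>d $ i\<close> is positive,
  the entry is detected.\<close>

lemma lie_bracket_model_offdiag:
  assumes "i \<noteq> j"
  shows "(lie_bracket (lin_vfield B) model $ i) (d + axis j 1) = of_nat (d $ i) * B $ i $ j"
proof -
  have euler: "mps_euler p q (model $ i) (d + axis j 1) =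
    (if p = i \<and> q = j then of_nat (d $ i + 1) else 0)" for p q
  proof -
    \<comment> \<open>The subtraction is exact because \<open>d $ q\<close> is positive.\<close>
    define e where "e = d + axis j 1 - axis q 1"
    have e: "e + axis q 1 = d + axis j 1"
      using d_pos[of q] by (auto simp: e_def vec_eq_iff axis_def)
    have "total_degree e = total_degree d"
      using arg_cong[OF e, of total_degree] by (simp add: total_degree_add total_degree_axis[simplified])
    then have coeff: "(model $ i) (e + axis p 1) = (if e + axis p 1 = d + axis i 1 then 1 else 0)"
      by (intro model_coeff) (simp add: total_degree_add total_degree_axis[simplified])
    have iff: "e + axis p 1 = d + axis i 1 \<longleftrightarrow> p = i \<and> q = j"
    proof
      assume *: "e + axis p 1 = d + axis i 1"
      have "d + (axis i 1 + axis q 1) = e + axis p 1 + axis q 1"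
        unfolding * by (simp only: add.assoc)
      also have "\<dots> = e + axis q 1 + axis p 1"
        by (simp only: add_ac)
      also have "\<dots> = d + (axis j 1 + axis p 1)"
        unfolding e by (simp only: add.assoc)
      finally have **: "axis i 1 + axis q 1 = (axis j 1 + axis p 1 :: (nat, 'n) vec)"
        by simp
      \<comment> \<open>The left side is positive at \<open>i\<close>, and \<open>axis j 1\<close>
        contributes nothing there since \<open>i\<close> and \<open>j\<close> differ; so
        \<open>p\<close> must be \<open>i\<close>.\<close>
      have "(axis i 1 + axis q 1 :: (nat, 'n) vec) $ i = (axis j 1 + axis p 1 :: (nat, 'n) vec) $ i"
        unfolding ** ..
      then have "p = i"
        using assms by (auto simp: axis_def split: if_splits)
      moreover from this ** have "axis q 1 + axis i 1 = (axis j 1 + axis i 1 :: (nat, 'n) vec)"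
        by (simp only: add.commute)
      then have "q = j"
        by (simp add: axis_eq_axis)
      ultimately show "p = i \<and> q = j" ..
    qed (use e in auto)
    have nz: "(d + axis j 1) $ q \<noteq> 0"
      using d_pos[of q] by simp
    have "mps_euler p q (model $ i) (d + axis j 1) = of_nat (e $ p + 1) * (model $ i) (e + axis p 1)"
      unfolding mps_euler_def mps_pderiv_def if_not_P[OF nz] e_def by (rule refl)
    moreover have "e $ i = d $ i" if "q = j"
      using e that by simp
    ultimately show ?thesis
      using coeff iff by auto
  qed
  have "(\<Sum>p\<in>UNIV. \<Sum>q\<in>UNIV. B $ p $ q * mps_euler p q (model $ i) (d + axis j 1)) =
      (\<Sum>p\<in>UNIV. \<Sum>q\<in>UNIV. if p = i then (if q = j then B $ i $ j * of_nat (d $ i + 1) else 0) else 0)"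
    unfolding euler by (intro sum.cong) auto
  also have "\<dots> = (\<Sum>p\<in>UNIV. if p = i then B $ i $ j * of_nat (d $ i + 1) else 0)"
    by (intro sum.cong) auto
  also have "\<dots> = B $ i $ j * of_nat (d $ i + 1)"
    by simp
  finally have 1: "(\<Sum>p\<in>UNIV. \<Sum>q\<in>UNIV. B $ p $ q * mps_euler p q (model $ i) (d + axis j 1)) =
      B $ i $ j * of_nat (d $ i + 1)" .
  have "(\<Sum>q\<in>UNIV. B $ i $ q * (model $ q) (d + axis j 1)) = (\<Sum>q\<in>UNIV. if q = j then B $ i $ j else 0)"
    by (intro sum.cong refl, subst model_coeff)
       (auto simp: total_degree_add total_degree_axis[simplified] axis_eq_axis)
  then have 2: "(\<Sum>q\<in>UNIV. B $ i $ q * (model $ q) (d + axis j 1)) = B $ i $ j"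
    by simp
  show ?thesis
    by (simp only: lie_bracket_lin_vfield 1 2) (simp add: algebra_simps)
qed

text \<open>The off-diagonal rows make a kernel element diagonal. The remaining rows are then
  exactly the hypotheses of \<open>a_complete\<close>, the eigenvalue at \<open>x^a x_i\<close> in
  component \<open>i\<close> being the pairing of \<open>a\<close> with \<open>mu\<close>.\<close>

lemma det_test_matrix_model: "det (test_matrix model) \<noteq> 0"
  unfolding det_nz_iff_kernel
proof (intro allI impI)
  fix v assume v: "test_matrix model *v v = 0"
  define B where "B = (\<chi> p q. v $ (p, q))"
  have v_eq: "v = vec_lambda (\<lambda>(p, q). B $ p $ q)"
    by (simp add: vec_eq_iff B_def)
  have eqs: "(if i = j \<and> i \<in> I then B $ i $ i
      else (lie_bracket (lin_vfield B) model $ i) (test_exponent i j)) = 0" for i j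
    using v test_matrix_vec[of model B i j] by (simp add: v_eq)
  have offdiag: "B $ i $ j = 0" if "i \<noteq> j" for i j
    using eqs[of i j] that d_pos[of i] by (simp add: test_exponent_def lie_bracket_model_offdiag[simplified])
  define mu where "mu = (\<chi> i. B $ i $ i)"
  have B: "B = diag_mat mu"
    using offdiag by (simp add: diag_mat_def mu_def vec_eq_iff)
  have "(\<Sum>j\<in>UNIV. of_nat (a i $ j) * mu $ j) = 0" if "i \<notin> I" for i
  proof -
    have "(model $ i) (a i + axis i 1) = 1"
      by (auto simp: model_def radial_field_def)
    moreover have "(lie_bracket (lin_vfield (diag_mat mu)) model $ i) (a i + axis i 1) = 0"
      using eqs[of i i] that unfolding B by (simp add: test_exponent_def)
    ultimately show ?thesis
      unfolding lie_bracket_diag sum_add_axis by simp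
  qed
  moreover have "mu $ i = 0" if "i \<in> I" for i
    using eqs[of i i] that by (simp add: mu_def)
  ultimately have "mu = 0" by (rule a_complete[rotated])
  with B have "B = 0" by (simp add: diag_mat_def vec_eq_iff)
  then show "v = 0" by (simp add: v_eq vec_eq_iff)
qed

text \<open>All exponents of \<open>d\<close> and \<open>a\<close> are positive, so there are no
  linear terms; resonance is \<open>resonant_add_axis\<close>.\<close>

lemma model_in_pdnf_space:
  obtains m where "m \<ge> 1" "model \<in> pdnf_space (diag_mat lam) m"
proof -
  define m where "m = 1 + Max (total_degree ` insert d (range a))"
  have pos: "b $ j > 0" if "b \<in> insert d (range a)" for b j
    using that d_pos[of j] a_gt[of j] by (auto intro: less_trans)
  have "1 \<le> total_degree k \<and> total_degree k \<le> m \<and> resonant lam i k" if "(model $ i) k \<noteq> 0" for i k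
  proof -
    obtain b where b: "b \<in> insert d (range a)" "k = b + axis i 1"
      using \<open>(model $ i) k \<noteq> 0\<close> by (auto simp: model_def radial_field_def split: if_splits)
    then have "total_degree b \<le> Max (total_degree ` insert d (range a))"
      by (intro Max_ge) auto
    moreover have "resonant lam i k"
      using b d_rel a_rel resonant_add_axis by auto
    ultimately show ?thesis
      using b by (simp add: m_def total_degree_add total_degree_axis[simplified])
  qed
  moreover have "linear_part model = 0"
  proof -
    have "axis j 1 \<noteq> b + axis i 1" if b: "b \<in> insert d (range a)" for b and i j :: 'n
    proof
      assume "axis j 1 = b + axis i 1"
      then have "axis j 1 $ i = b $ i + 1" by simp
      then show False
        using pos[OF b, of i] by (simp add: axis_def split: if_splits)
    qed
    then have "(model $ i) (axis j 1) = 0" for i j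
      by (auto simp: model_def radial_field_def)
    then show ?thesis by (simp add: linear_part_def vec_eq_iff)
  qed
  ultimately have "model \<in> pdnf_space (diag_mat lam) m"
    unfolding pdnf_space_iff by (simp add: strictly_upper_def)
  moreover have "m \<ge> 1" by (simp add: m_def)
  ultimately show ?thesis using that by blast
qed

text \<open>From a commuting \<open>B\<close>, subtract the known solution with the same diagonal
  entries at \<open>I\<close>. The difference solves the homogeneous test system and is therefore
  0.\<close>

lemma edim_linear_centralizer:
  assumes g: "g \<in> pdnf_space (diag_mat lam) m" and det: "det (test_matrix g) \<noteq> 0"
  shows "vf_edim (centralizer (lin_vfield (diag_mat lam) + g) \<inter> range lin_vfield) = enat (rat_rank lam)"
proof -
  let ?f = "lin_vfield (diag_mat lam) + g"
  have comm: "lie_bracket (lin_vfield (diag_mat lam)) ?f = 0"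
    using g by (simp add: pdnf_space_def pdnf_def)
  have "x \<in> vf.span (diag_basis ` I)" if x: "x \<in> centralizer ?f \<inter> range lin_vfield" for x
  proof -
    obtain B where B: "x = lin_vfield B" "lie_bracket (lin_vfield B) ?f = 0"
      using x by (auto simp: centralizer_def)
    define mu where "mu = rat_diag (\<lambda>b. B $ b $ b)"
    define C where "C = B - diag_mat mu"
    have "lie_bracket (lin_vfield C) ?f = 0"
      using B rat_diag_in_centralizer[OF comm] unfolding C_def mu_def
      by (simp add: lie_bracket_lin_vfield_diff centralizer_def)
    then have sum0: "(lie_bracket (lin_vfield C) (lin_vfield (diag_mat lam)) $ i) k
        + (lie_bracket (lin_vfield C) g $ i) k = 0" for i k
      by (simp add: lie_bracket_lin_vfield_add vec_eq_iff fun_eq_iff)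
    \<comment> \<open>The bracket of \<open>C\<close> with \<open>A_s\<close> is linear and vanishes
      at these exponents, so only \<open>g\<close> is left.\<close>
    have "total_degree (test_exponent i j) \<noteq> 1" for i j
    proof -
      have "d $ i \<le> total_degree d"
        unfolding total_degree_def by (intro member_le_sum) auto
      then show ?thesis
        using d_pos[of i] degree_a[of i]
        by (auto simp: test_exponent_def total_degree_add total_degree_axis[simplified])
    qed
    then have "(lie_bracket (lin_vfield C) g $ i) (test_exponent i j) = 0" for i j
      using sum0[of i "test_exponent i j"] by (simp add: lie_bracket_linear_eq_0)
    moreover have "C $ b $ b = 0" if "b \<in> I" for b
      using that by (simp add: C_def mu_def diag_mat_def rat_diag_I)
    ultimately have "(test_matrix g *v vec_lambda (\<lambda>(p, q). C $ p $ q)) $ (i, j) = 0" for i j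
      unfolding test_matrix_vec by metis
    then have "test_matrix g *v vec_lambda (\<lambda>(p, q). C $ p $ q) = 0"
      by (simp add: vec_eq_iff)
    then have "vec_lambda (\<lambda>(p, q). C $ p $ q) = 0"
      using det unfolding det_nz_iff_kernel by blast
    then have "C = 0"
      by (simp add: vec_eq_iff)
    then have "B = diag_mat mu"
      by (simp add: C_def)
    then have "x = lin_vfield (diag_mat mu)"
      by (simp only: B(1))
    then have "x = (\<Sum>b\<in>I. vf_scale (B $ b $ b) (diag_basis b))"
      unfolding mu_def lin_rat_diag .
    then show ?thesis
      by (simp add: vf.span_sum vf.span_scale vf.span_base)
  qed
  then have "centralizer ?f \<inter> range lin_vfield \<subseteq> vf.span (diag_basis ` I)"
    by (rule subsetI)
  then have "vf_edim (centralizer ?f \<inter> range lin_vfield) = enat (card (diag_basis ` I))"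
    by (intro vf_edim_eq_card independent_diag_basis diag_basis_in_centralizer[OF comm]
        finite_imageI finite)
  then show ?thesis
    unfolding card_diag_basis .
qed

text \<open>The bound \<open>m\<close> is chosen so that the space contains \<open>model\<close>,
  the base point of the lines in the density argument.\<close>

lemma generic_linear_centralizer:
  "Z_generically (diag_mat lam)
    (\<lambda>f. vf_edim (centralizer f \<inter> range lin_vfield) = enat (rat_rank lam))"
proof -
  obtain m where m: "m \<ge> 1" "model \<in> pdnf_space (diag_mat lam) m"
    using model_in_pdnf_space by blast
  let ?U = "{g \<in> pdnf_space (diag_mat lam) m. det (test_matrix g) \<noteq> 0}"
  have "zariski_dense_in (pdnf_space (diag_mat lam) m) ?U"
    using poly_functions_test_matrix m(2) det_test_matrix_model vf_line_in_pdnf_space[OF m(2)]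
    by (rule zariski_dense_nonvanishing)
  with m(1) show ?thesis
    unfolding Z_generically_def
    by (intro exI[of _ m] exI[of _ ?U] conjI)
       (auto simp: zariski_open_nonvanishing poly_functions_test_matrix edim_linear_centralizer)
qed

end

theorem theorem4:
  fixes lam :: "complex ^ 'n::{finite,linorder}"
  assumes "\<exists>d :: 'n \<Rightarrow> int. (\<forall>i. d i > 0) \<and> (\<Sum>i\<in>UNIV. of_int (d i) * lam $ i) = 0"
  shows "(\<forall>f. pdnf (diag_mat lam) f \<longrightarrow>
            vf_edim (centralizer f \<inter> range lin_vfield) \<ge> enat (rat_rank lam) \<and>
            vf_edim (centralizer f) \<ge> enat (rat_rank lam + 1)) \<and>
         Z_generically (diag_mat lam)
           (\<lambda>f. vf_edim (centralizer f \<inter> range lin_vfield) = enat (rat_rank lam))"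
proof -
  obtain e :: "'n \<Rightarrow> int" where e: "\<And>i. e i > 0" "(\<Sum>i\<in>UNIV. of_int (e i) * lam $ i) = 0"
    using assms by blast
  define d :: "(nat, 'n) vec" where "d = (\<chi> i. nat (e i))"
  have "of_nat (d $ i) = (of_int (e i) :: complex)" for i
    using e(1)[of i] by (simp add: d_def)
  then have d: "\<And>i. d $ i > 0" "(\<Sum>i\<in>UNIV. of_nat (d $ i) * lam $ i) = 0"
    using e by (simp_all add: d_def)
  obtain I R where IR: "card I = rat_rank lam"
    "\<And>i b. i \<in> I \<Longrightarrow> b \<in> I \<Longrightarrow> R i b = (if i = b then 1 else 0)"
    "\<And>i. lam $ i = (\<Sum>b\<in>I. of_rat (R i b) * lam $ b)"
    "\<And>(u :: 'n \<Rightarrow> rat) b. (\<Sum>b\<in>I. of_rat (u b) * lam $ b) = 0 \<Longrightarrow> b \<in> I \<Longrightarrow> u b = 0"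
    using rational_index_basis[of lam] by blast
  obtain a :: "'n \<Rightarrow> (nat, 'n) vec" where a: "\<And>i j. d $ j < a i $ j"
    "\<And>i. (\<Sum>j\<in>UNIV. of_nat (a i $ j) * lam $ j) = 0"
    "\<And>v :: (complex, 'n) vec. (\<And>i. i \<in> I \<Longrightarrow> v $ i = 0) \<Longrightarrow>
      (\<And>i. i \<notin> I \<Longrightarrow> (\<Sum>j\<in>UNIV. of_nat (a i $ j) * v $ j) = 0) \<Longrightarrow> v = 0"
    using positive_relations[OF d IR(3)] by blast
  interpret relation_basis lam d I R a
    by unfold_locales (fact d IR a)+
  show ?thesis
    using edim_centralizer_ge generic_linear_centralizer by blast
qed

end
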